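(* Let $(O_1)$ and $(O_2)$ be the internal circles of an arbelos, with radii $R_1,R_2>0$, tangent to each other at $M$, let $(O)$ be its external circle, let $l$ be the line through $M$ perpendicular to $O_1O_2$, and fix one of the two open half-planes $H$ bounded by the line $O_1O_2$. Let $(S_1)$ and $(S_2)$ be the circles of diameters $[O_1M]$ and $[O_2M]$. Let $D_2$ be the pole with respect to $(O_2)$ of the tangent from $O_1$ to $(S_2)$ whose point of contact lies in $H$, and let $D_1$ be the pole with respect to $(O_1)$ of the tangent from $O_2$ to $(S_1)$ whose point of contact lies in $H$. Then the circle centered at $D_1$ of radius $O_1D_1-R_1$ and the circle centered at $D_2$ of radius $O_2D_2-R_2$ are the twins $\omega_1$ and $\omega_2$ of the arbelos: for $i=1,2$ the circle centered at $D_i$ is tangent to $(O_i)$, to $(O)$ and to the line $l$. Moreover the two circles have the same radius $r$, and $$\frac1r=\frac1{R_1}+\frac1{R_2}.$$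
   Context: Arbelos: $(O_1)$ and $(O_2)$ are circles with centers $O_1,O_2$ and radii $R_1,R_2>0$, externally tangent at the point $M$. The external circle $(O)$ has center $O$ on the line $O_1O_2$ and radius $R_1+R_2$, and is internally tangent to $(O_1)$ at $A_1$ and to $(O_2)$ at $A_2$, so that $A_1,O_1,M,O_2,A_2$ lie on one line in this order and $[A_1A_2]$ is a diameter of $(O)$. Twins: for $i=1,2$, the twin $\omega_i$ is the circle with center in $H$, lying in the closed half-plane bounded by $l$ that contains $O_i$, which is tangent to $l$, externally tangent to $(O_i)$ and internally tangent to $(O)$. Pole: given a circle with center $\Omega$ and radius $\rho$ and a line $p$ not passing through $\Omega$, the pole of $p$ with respect to this circle is the inverse, with respect to the circle, of the orthogonal projection $P$ of $\Omega$ onto $p$; that is, the point $D$ on the ray $\Omega P$ with $\Omega P\cdot\Omega D=\rho^2$. For points $X,Y$, $XY$ denotes the distance between them when used in formulas. *)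

theory Defs
  imports "HOL-Analysis.Analysis"
begin

type_synonym point = "real^2"

text \<open>Lines are one-dimensional affine subsets of the plane. Circles are given either by centre
  and radius or, where only the point set matters, as the set \<open>sphere c r\<close>.\<close>

definition tangent_line_at :: "point set \<Rightarrow> point set \<Rightarrow> point \<Rightarrow> bool" where
  "tangent_line_at p C T \<longleftrightarrow> affine p \<and> aff_dim p = 1 \<and> p \<inter> C = {T}"

definition externally_tangent_at :: "point \<Rightarrow> real \<Rightarrow> point \<Rightarrow> real \<Rightarrow> point \<Rightarrow> bool" where
  "externally_tangent_at a r b s T \<longleftrightarrow>
     sphere a r \<inter> sphere b s = {T} \<and> ball a r \<inter> ball b s = {}"

text \<open>The circle \<open>(a, r)\<close> is the inner one.\<close>

definition internally_tangent_at :: "point \<Rightarrow> real \<Rightarrow> point \<Rightarrow> real \<Rightarrow> point \<Rightarrow> bool" where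
  "internally_tangent_at a r b s T \<longleftrightarrow>
     sphere a r \<inter> sphere b s = {T} \<and> cball a r \<subseteq> cball b s"

definition open_half_plane :: "point set \<Rightarrow> point set \<Rightarrow> bool" where
  "open_half_plane p H \<longleftrightarrow>
     (\<exists>a b. a \<noteq> 0 \<and> p = {x. a \<bullet> x = b} \<and> H = {x. a \<bullet> x > b})"

definition closed_half_plane :: "point set \<Rightarrow> point set \<Rightarrow> bool" where
  "closed_half_plane p K \<longleftrightarrow>
     (\<exists>a b. a \<noteq> 0 \<and> p = {x. a \<bullet> x = b} \<and> K = {x. a \<bullet> x \<ge> b})"

definition circle_on_diameter :: "point \<Rightarrow> point \<Rightarrow> point set" where
  "circle_on_diameter A B = sphere (midpoint A B) (dist A B / 2)"

definition tangent_from :: "point \<Rightarrow> point set \<Rightarrow> point set \<Rightarrow> point set" where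
  "tangent_from P C H = (THE p. P \<in> p \<and> (\<exists>T\<in>H. tangent_line_at p C T))"

definition orthogonal_projection :: "point set \<Rightarrow> point \<Rightarrow> point" where
  "orthogonal_projection p X = (THE P. P \<in> p \<and> (\<forall>Y\<in>p. orthogonal (X - P) (Y - P)))"

definition circle_inverse :: "point \<Rightarrow> real \<Rightarrow> point \<Rightarrow> point" where
  "circle_inverse c r P =
     (THE D. (\<exists>t\<ge>0. D = c + t *\<^sub>R (P - c)) \<and> dist c P * dist c D = r\<^sup>2)"

text \<open>Only meaningful if the line \<open>p\<close> does not pass through \<open>c\<close>.\<close>

definition pole :: "point \<Rightarrow> real \<Rightarrow> point set \<Rightarrow> point" where
  "pole c r p = circle_inverse c r (orthogonal_projection p c)"

text \<open>The points \<open>A1, O1, M, O2, A2\<close> then lie on one line in this order, and \<open>A1\<close>, \<open>A2\<close> are the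
  ends of a diameter of the external circle, whose centre is \<open>Q\<close>.\<close>

definition arbelos ::
  "point \<Rightarrow> real \<Rightarrow> point \<Rightarrow> real \<Rightarrow> point \<Rightarrow> point \<Rightarrow> point \<Rightarrow> point \<Rightarrow> bool" where
  "arbelos O1 R1 O2 R2 M Q A1 A2 \<longleftrightarrow>
     R1 > 0 \<and> R2 > 0 \<and>
     externally_tangent_at O1 R1 O2 R2 M \<and>
     Q \<in> affine hull {O1, O2} \<and>
     internally_tangent_at O1 R1 Q (R1 + R2) A1 \<and>
     internally_tangent_at O2 R2 Q (R1 + R2) A2"

definition perpendicular_at :: "point \<Rightarrow> point \<Rightarrow> point \<Rightarrow> point set" where
  "perpendicular_at M A B = {x. orthogonal (x - M) (B - A)}"

text \<open>The circle with centre \<open>c\<close> and radius \<open>r\<close> is the twin belonging to the internal circle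
  \<open>(P, R)\<close>, where \<open>(Q, S)\<close> is the external circle and \<open>l\<close> the perpendicular at the point of
  tangency of the internal circles.\<close>

definition is_twin ::
  "point set \<Rightarrow> point set \<Rightarrow> point \<Rightarrow> real \<Rightarrow> point \<Rightarrow> real \<Rightarrow> point \<Rightarrow> real \<Rightarrow> bool" where
  "is_twin H l P R Q S c r \<longleftrightarrow>
     r > 0 \<and> c \<in> H \<and>
     (\<exists>K. closed_half_plane l K \<and> P \<in> K \<and> sphere c r \<subseteq> K) \<and>
     (\<exists>T. tangent_line_at l (sphere c r) T) \<and>
     (\<exists>T. externally_tangent_at c r P R T) \<and>
     (\<exists>T. internally_tangent_at c r Q S T)"

end

theory Submission
  imports Defs
begin

text \<open>
  Place the origin at \<open>M\<close>, the first axis along \<open>O1 O2\<close> and the second into \<open>H\<close>, so that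
  \<open>O1 = (-R1, 0)\<close>, \<open>O2 = (R2, 0)\<close> and \<open>Q = (R2 - R1, 0)\<close>. A twin of radius \<open>r\<close> next to \<open>(O1)\<close>
  touches \<open>l\<close> from the side of \<open>O1\<close>, hence its centre is \<open>(-r, y)\<close>. Tangency to \<open>(O1)\<close> says
  \<open>(R1 - r)\<^sup>2 + y\<^sup>2 = (R1 + r)\<^sup>2\<close>, and tangency to the external circle says
  \<open>(R2 - R1 + r)\<^sup>2 + y\<^sup>2 = (R1 + R2 - r)\<^sup>2\<close>. Subtracting removes \<open>y\<close> and leaves the linear equation
  \<open>r (R1 + R2) = R1 R2\<close>; then \<open>y > 0\<close> is determined too. So there is exactly one twin on each side,
  and its radius is symmetric in \<open>R1\<close> and \<open>R2\<close> (\<open>is_twin_iff\<close>).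

  The pole is computed from the radius vector \<open>w\<close> to the point of contact. Let \<open>c\<close> be the centre of
  the circle of diameter \<open>[O1 M]\<close>, \<open>s = R1 / 2\<close> its radius, and \<open>d = R2 + s\<close> the distance from \<open>c\<close> to
  \<open>O2\<close>. The tangent through \<open>O2\<close> is perpendicular to \<open>w\<close> at \<open>c + w\<close>, so \<open>w\<close> has length \<open>s\<close> and first
  coordinate \<open>s\<^sup>2 / d\<close>, and the half-plane fixes its sign. The pole then is \<open>O1 + k w\<close> with
  \<open>k = 4 d / (s + d)\<close>: its distance from \<open>O1\<close> is \<open>k s = R1 + r\<close>, and its first coordinate is \<open>-r\<close>,
  which are the two properties that single out the centre of the twin (\<open>pole_tangent_from\<close>).

  Both computations concern one side only, so they are carried out in a locale for an orthonormal
  frame \<open>e, n\<close> at \<open>M\<close> and used twice, the second time with \<open>-e\<close> for \<open>e\<close> and the two radii exchanged.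
\<close>

section \<open>Tangency in metric terms\<close>

lemma dist_sum_collinear:
  fixes a b x :: point
  assumes "dist a b = dist a x + dist x b"
  shows "dist a x *\<^sub>R (x - b) = dist x b *\<^sub>R (a - x)"
  using assms unfolding dist_triangle_eq by (simp only: dist_norm)

lemma reflection_fixed:
  fixes F T :: point
  assumes "F - (T - F) = T"
  shows "T = F"
proof -
  have "T $ i = F $ i" for i
    using arg_cong[OF assms, of "\<lambda>v. v $ i"] unfolding vector_minus_component by linarith
  then show ?thesis by (simp add: vec_eq_iff)
qed

text \<open>If the centres were closer than \<open>r + s\<close>, the point that divides the segment between them in the
  ratio \<open>r : s\<close> would lie in both discs; a common point of the circles excludes a larger distance.
  When the distance is exactly \<open>r + s\<close>, a common point gives equality in the triangle inequality
  and so lies on the segment.\<close>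

lemma externally_tangent_at_iff:
  assumes "r > 0" "s > 0"
  shows "externally_tangent_at a r b s T \<longleftrightarrow>
           dist a b = r + s \<and> T = a + (r / (r + s)) *\<^sub>R (b - a)"
proof
  assume *: "externally_tangent_at a r b s T"
  then have T: "dist a T = r" "dist b T = s"
    and disj: "ball a r \<inter> ball b s = {}"
    unfolding externally_tangent_at_def by auto
  have "dist a b \<ge> r + s"
  proof (rule ccontr)
    assume "\<not> dist a b \<ge> r + s"
    then have less: "dist a b < r + s" by simp
    define x where "x = a + (r / (r + s)) *\<^sub>R (b - a)"
    have "dist a x = r / (r + s) * dist a b"
      using assms by (simp add: x_def dist_norm norm_minus_commute)
    moreover have "dist b x = s / (r + s) * dist a b"
    proof -
      have "b - x = (s / (r + s)) *\<^sub>R (b - a)"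
        using assms by (simp add: x_def algebra_simps add_divide_distrib [symmetric]
            flip: scaleR_add_left)
      then show ?thesis using assms by (simp add: dist_norm norm_minus_commute)
    qed
    moreover have "u / (r + s) * dist a b < u" if "u > 0" for u
      using mult_strict_left_mono[OF less that] assms by (simp add: divide_less_eq)
    ultimately have "dist a x < r" "dist b x < s"
      using assms by simp_all
    then show False using disj by auto
  qed
  moreover have "dist a b \<le> r + s"
    using dist_triangle[of a b T] T by (simp add: dist_commute)
  ultimately have d: "dist a b = r + s" by simp
  then have "dist a b = dist a T + dist T b" using T by (simp add: dist_commute)
  then have "r *\<^sub>R (T - b) = s *\<^sub>R (a - T)"
    using dist_sum_collinear[of a b T] T by (simp add: dist_commute)
  then have "(r + s) *\<^sub>R T = (r + s) *\<^sub>R a + r *\<^sub>R (b - a)"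
    by (simp add: algebra_simps)
  also have "\<dots> = (r + s) *\<^sub>R (a + (r / (r + s)) *\<^sub>R (b - a))"
    using assms by (simp add: scaleR_add_right[of _ a])
  finally have "(r + s) *\<^sub>R T = (r + s) *\<^sub>R (a + (r / (r + s)) *\<^sub>R (b - a))" .
  then show "dist a b = r + s \<and> T = a + (r / (r + s)) *\<^sub>R (b - a)"
    using d assms by simp
next
  assume *: "dist a b = r + s \<and> T = a + (r / (r + s)) *\<^sub>R (b - a)"
  then have d: "dist a b = r + s" and T: "T = a + (r / (r + s)) *\<^sub>R (b - a)" by auto
  have Ta: "dist a T = r"
    using assms d by (simp add: T dist_norm norm_minus_commute)
  have "b - T = (s / (r + s)) *\<^sub>R (b - a)"
    using assms by (simp add: T algebra_simps add_divide_distrib [symmetric]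
        flip: scaleR_add_left)
  then have Tb: "dist b T = s"
    using assms d by (simp add: dist_norm norm_minus_commute)
  have uniq: "x = T" if "dist a x = r" "dist b x = s" for x
  proof -
    have "dist a b = dist a x + dist x b" using that d by (simp add: dist_commute)
    then have "r *\<^sub>R (x - b) = s *\<^sub>R (a - x)"
      using dist_sum_collinear[of a b x] that by (simp add: dist_commute)
    then have "(r + s) *\<^sub>R x = (r + s) *\<^sub>R a + r *\<^sub>R (b - a)"
      by (simp add: algebra_simps)
    also have "\<dots> = (r + s) *\<^sub>R T"
      using assms by (simp add: T scaleR_add_right[of _ a])
    finally have "(r + s) *\<^sub>R x = (r + s) *\<^sub>R T" .
    then show ?thesis using assms by simp
  qed
  have "ball a r \<inter> ball b s = {}"
  proof -
    have False if "dist a x < r" "dist b x < s" for x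
      using dist_triangle[of a b x] that d by (simp add: dist_commute)
    then show ?thesis by auto
  qed
  moreover have "sphere a r \<inter> sphere b s = {T}"
    using Ta Tb uniq unfolding set_eq_iff Int_iff mem_sphere singleton_iff by blast
  ultimately show "externally_tangent_at a r b s T"
    unfolding externally_tangent_at_def by blast
qed

text \<open>Here the equality case of the triangle inequality puts the point of contact on the ray from \<open>b\<close>
  through \<open>a\<close>. Equal radii are excluded because the circles would then coincide, and a circle of
  positive radius has more than one point.\<close>

lemma internally_tangent_at_iff:
  assumes "r > 0"
  shows "internally_tangent_at a r b s T \<longleftrightarrow>
           r < s \<and> dist a b = s - r \<and> T = a + (r / (s - r)) *\<^sub>R (a - b)"
proof
  assume *: "internally_tangent_at a r b s T"
  then have T: "dist a T = r" "dist b T = s"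
    and sub: "cball a r \<subseteq> cball b s" and uniq: "sphere a r \<inter> sphere b s = {T}"
    unfolding internally_tangent_at_def by auto
  have "dist a b + r \<le> s"
    using sub assms by (simp add: cball_subset_cball_iff)
  moreover have "s \<le> dist a b + r"
    using dist_triangle[of b T a] T by (simp add: dist_commute)
  ultimately have d: "dist a b = s - r" by simp
  have "r \<noteq> s"
  proof
    assume "r = s"
    then have "a = b" using d by simp
    define T' where "T' = a - (T - a)"
    have "a - T' = T - a" by (simp add: T'_def)
    then have "dist a T' = r" using T by (metis dist_commute dist_norm)
    then have "T' \<in> sphere a r \<inter> sphere b s" using \<open>a = b\<close> \<open>r = s\<close> by simp
    then have "T' = T" unfolding uniq by (rule singletonD)
    then have "T = a" unfolding T'_def by (rule reflection_fixed)
    then show False using T assms by simp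
  qed
  then have rs: "r < s" using d zero_le_dist[of a b] by linarith
  have "dist b T = dist b a + dist a T" using T d by (simp add: dist_commute)
  then have "(s - r) *\<^sub>R (a - T) = r *\<^sub>R (b - a)"
    using dist_sum_collinear[of b T a] T d by (simp add: dist_commute)
  then have "(s - r) *\<^sub>R T = (s - r) *\<^sub>R a + r *\<^sub>R (a - b)"
    by (simp add: algebra_simps)
  also have "\<dots> = (s - r) *\<^sub>R (a + (r / (s - r)) *\<^sub>R (a - b))"
    using rs by (simp add: scaleR_add_right[of _ a])
  finally have "(s - r) *\<^sub>R T = (s - r) *\<^sub>R (a + (r / (s - r)) *\<^sub>R (a - b))" .
  then show "r < s \<and> dist a b = s - r \<and> T = a + (r / (s - r)) *\<^sub>R (a - b)"
    using d rs by simp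
next
  assume *: "r < s \<and> dist a b = s - r \<and> T = a + (r / (s - r)) *\<^sub>R (a - b)"
  then have rs: "r < s" and d: "dist a b = s - r"
    and T: "T = a + (r / (s - r)) *\<^sub>R (a - b)" by auto
  have Ta: "dist a T = r"
    using assms d rs by (simp add: T dist_norm)
  have "T - b = (s / (s - r)) *\<^sub>R (a - b)"
  proof -
    have "s / (s - r) = 1 + r / (s - r)" using rs by (simp add: field_simps)
    then show ?thesis by (simp add: T scaleR_add_left)
  qed
  then have Tb: "dist b T = s"
    using assms d rs by (simp add: dist_norm norm_minus_commute[of b])
  have uniq: "x = T" if "dist a x = r" "dist b x = s" for x
  proof -
    have "dist b x = dist b a + dist a x" using that d by (simp add: dist_commute)
    then have "(s - r) *\<^sub>R (a - x) = r *\<^sub>R (b - a)"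
      using dist_sum_collinear[of b x a] that d by (simp add: dist_commute)
    then have "(s - r) *\<^sub>R x = (s - r) *\<^sub>R a + r *\<^sub>R (a - b)"
      by (simp add: algebra_simps)
    also have "\<dots> = (s - r) *\<^sub>R T"
      using rs by (simp add: T scaleR_add_right[of _ a])
    finally have "(s - r) *\<^sub>R x = (s - r) *\<^sub>R T" .
    then show ?thesis using rs by simp
  qed
  have "cball a r \<subseteq> cball b s"
    using d by (simp add: cball_subset_cball_iff)
  moreover have "sphere a r \<inter> sphere b s = {T}"
    using Ta Tb uniq unfolding set_eq_iff Int_iff mem_sphere singleton_iff by blast
  ultimately show "internally_tangent_at a r b s T"
    unfolding internally_tangent_at_def by blast
qed

text \<open>A line and a circle are both symmetric about the perpendicular from the centre to the line.
  If they share only one point, that point is its own mirror image, so it is the foot of this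
  perpendicular. Pythagoras gives the converse.\<close>

lemma tangent_line_at_iff:
  assumes "r > 0"
  shows "tangent_line_at p (sphere c r) T \<longleftrightarrow>
           dist c T = r \<and> p = {x. (T - c) \<bullet> (x - T) = 0}"
proof
  assume "tangent_line_at p (sphere c r) T"
  then have p: "affine p" "aff_dim p = 1" and int: "p \<inter> sphere c r = {T}"
    unfolding tangent_line_at_def by auto
  obtain a b where a: "a \<noteq> 0" and pab: "p = {x. a \<bullet> x = b}"
    using p aff_dim_eq_hyperplane[of p] by (auto simp: hull_same)
  have T: "dist c T = r" "a \<bullet> T = b" using int pab by auto
  \<comment> \<open>\<open>F\<close> is the foot of the perpendicular from the centre, \<open>T'\<close> the mirror image of \<open>T\<close>.\<close>
  define F where "F = c - ((a \<bullet> c - b) / (a \<bullet> a)) *\<^sub>R a"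
  define T' where "T' = F - (T - F)"
  have F: "a \<bullet> F = b" using a by (simp add: F_def inner_diff_right)
  have cF: "c - F = ((a \<bullet> c - b) / (a \<bullet> a)) *\<^sub>R a" by (simp add: F_def)
  have "(c - F) \<bullet> (F - T) = 0" using F T by (simp add: cF inner_diff_right)
  moreover have "c - T = (c - F) + (F - T)" "c - T' = (c - F) - (F - T)"
    by (simp_all add: T'_def)
  ultimately have "(norm (c - T'))\<^sup>2 = (norm (c - T))\<^sup>2"
    by (simp only: power2_norm_eq_inner inner_add_left inner_add_right
        inner_diff_left inner_diff_right) (simp add: inner_commute)
  then have "dist c T' = r" using T by (simp add: dist_norm)
  moreover have "a \<bullet> T' = b" using F T unfolding T'_def inner_diff_right by simp
  ultimately have "T' \<in> p \<inter> sphere c r" using pab by simp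
  then have "T' = T" unfolding int by (rule singletonD)
  then have "T = F" unfolding T'_def by (rule reflection_fixed)
  then obtain k where k: "T - c = k *\<^sub>R a" by (simp add: F_def) (metis scaleR_minus_left)
  then have "k \<noteq> 0" using T assms by auto
  then show "dist c T = r \<and> p = {x. (T - c) \<bullet> (x - T) = 0}"
    using T by (auto simp: pab k inner_diff_right)
next
  assume *: "dist c T = r \<and> p = {x. (T - c) \<bullet> (x - T) = 0}"
  then have d: "norm (T - c) = r" by (simp add: dist_norm norm_minus_commute)
  then have nz: "T - c \<noteq> 0" using assms by auto
  have p: "p = {x. (T - c) \<bullet> x = (T - c) \<bullet> T}" using * by (auto simp: inner_diff_right)
  have uniq: "x = T" if "(T - c) \<bullet> (x - T) = 0" "dist c x = r" for x
  proof -
    have "x - c = (T - c) + (x - T)" by simp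
    then have "(norm (x - c))\<^sup>2 = (norm (T - c))\<^sup>2 + (norm (x - T))\<^sup>2"
      using that(1)
      by (simp only: power2_norm_eq_inner inner_add_left inner_add_right)
        (simp add: inner_commute)
    then show ?thesis using that d by (simp add: dist_norm norm_minus_commute)
  qed
  have "affine p" unfolding p by (rule affine_hyperplane)
  moreover have "aff_dim p = 1" unfolding p using nz by (subst aff_dim_hyperplane) auto
  moreover have "p \<inter> sphere c r = {T}"
    using * uniq inner_zero_right[of "T - c"]
    unfolding set_eq_iff Int_iff mem_sphere singleton_iff mem_Collect_eq
    by (metis diff_self)
  ultimately show "tangent_line_at p (sphere c r) T"
    unfolding tangent_line_at_def by blast
qed

section \<open>The pole of a line\<close>

lemma orthogonal_projection_hyperplane:
  fixes w T X :: point
  assumes "w \<noteq> 0"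
  shows "orthogonal_projection {x. w \<bullet> (x - T) = 0} X = X + (w \<bullet> (T - X) / (w \<bullet> w)) *\<^sub>R w"
    (is "_ = ?F")
  unfolding orthogonal_projection_def
proof (rule the_equality)
  have F: "w \<bullet> (?F - T) = 0"
    using assms by (simp add: inner_diff_right inner_add_right)
  moreover have "orthogonal (X - ?F) (Y - ?F)" if "w \<bullet> (Y - T) = 0" for Y
  proof -
    have "w \<bullet> (Y - ?F) = 0" using F that by (simp only: inner_diff_right)
    then show ?thesis by (simp add: orthogonal_def)
  qed
  ultimately show "?F \<in> {x. w \<bullet> (x - T) = 0} \<and>
      (\<forall>Y\<in>{x. w \<bullet> (x - T) = 0}. orthogonal (X - ?F) (Y - ?F))"
    by blast
  fix P assume P: "P \<in> {x. w \<bullet> (x - T) = 0} \<and>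
      (\<forall>Y\<in>{x. w \<bullet> (x - T) = 0}. orthogonal (X - P) (Y - P))"
  have 1: "(X - P) \<bullet> (?F - P) = 0" using P F by (simp add: orthogonal_def)
  have "w \<bullet> (?F - P) = 0" using P F by (simp add: inner_diff_right)
  then have 2: "(X - ?F) \<bullet> (?F - P) = 0" by simp
  have "(X - P) - (X - ?F) = ?F - P" by simp
  then have "(?F - P) \<bullet> (?F - P) = (X - P) \<bullet> (?F - P) - (X - ?F) \<bullet> (?F - P)"
    using inner_diff_left[of "X - P" "X - ?F" "?F - P"] by (simp only:)
  then have "?F - P = 0" using 1 2 by (simp only: inner_eq_zero_iff diff_self)
  then show "P = ?F" by simp
qed

lemma circle_inverse_eq:
  assumes "P \<noteq> c"
  shows "circle_inverse c r P = c + (r\<^sup>2 / (dist c P)\<^sup>2) *\<^sub>R (P - c)"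
  unfolding circle_inverse_def
proof (rule the_equality)
  have n: "norm (P - c) = dist c P" by (simp add: dist_norm norm_minus_commute)
  show "(\<exists>t\<ge>0. c + (r\<^sup>2 / (dist c P)\<^sup>2) *\<^sub>R (P - c) = c + t *\<^sub>R (P - c)) \<and>
      dist c P * dist c (c + (r\<^sup>2 / (dist c P)\<^sup>2) *\<^sub>R (P - c)) = r\<^sup>2"
  proof
    have "r\<^sup>2 / (dist c P)\<^sup>2 \<ge> 0" by simp
    then show "\<exists>t\<ge>0. c + (r\<^sup>2 / (dist c P)\<^sup>2) *\<^sub>R (P - c) = c + t *\<^sub>R (P - c)" by blast
    show "dist c P * dist c (c + (r\<^sup>2 / (dist c P)\<^sup>2) *\<^sub>R (P - c)) = r\<^sup>2"
      using assms by (simp add: dist_norm[of c "c + _"] n power2_eq_square)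
  qed
  fix D assume "(\<exists>t\<ge>0. D = c + t *\<^sub>R (P - c)) \<and> dist c P * dist c D = r\<^sup>2"
  then obtain t where t: "t \<ge> 0" "D = c + t *\<^sub>R (P - c)" "dist c P * dist c D = r\<^sup>2" by blast
  then have "t * (dist c P)\<^sup>2 = r\<^sup>2"
    by (simp add: dist_norm[of c "c + _"] n power2_eq_square mult_ac)
  then have "t = r\<^sup>2 / (dist c P)\<^sup>2" using assms by (simp add: field_simps)
  then show "D = c + (r\<^sup>2 / (dist c P)\<^sup>2) *\<^sub>R (P - c)" using t by simp
qed

text \<open>With \<open>k = w \<bullet> (T - c) / (w \<bullet> w)\<close> the projection of \<open>c\<close> is \<open>c + k w\<close>, and inversion replaces
  the factor \<open>k\<close> by \<open>r\<^sup>2 / (k (w \<bullet> w))\<close>. The length of \<open>w\<close> cancels, so \<open>w\<close> may be any normal vector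
  of the line.\<close>

lemma pole_hyperplane:
  fixes w T c :: point
  assumes "w \<bullet> (T - c) \<noteq> 0"
  shows "pole c r {x. w \<bullet> (x - T) = 0} = c + (r\<^sup>2 / (w \<bullet> (T - c))) *\<^sub>R w"
proof -
  define k where "k = w \<bullet> (T - c) / (w \<bullet> w)"
  have w: "w \<noteq> 0" using assms by auto
  then have k: "k \<noteq> 0" "w \<bullet> (T - c) = k * (w \<bullet> w)" using assms by (simp_all add: k_def)
  have proj: "orthogonal_projection {x. w \<bullet> (x - T) = 0} c = c + k *\<^sub>R w"
    using w by (simp add: orthogonal_projection_hyperplane k_def)
  have "(dist c (c + k *\<^sub>R w))\<^sup>2 = k\<^sup>2 * (w \<bullet> w)"
    by (simp add: dist_norm power_mult_distrib power2_norm_eq_inner)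
  then have "circle_inverse c r (c + k *\<^sub>R w) = c + (r\<^sup>2 / (k\<^sup>2 * (w \<bullet> w)) * k) *\<^sub>R w"
    using k w by (subst circle_inverse_eq) auto
  also have "r\<^sup>2 / (k\<^sup>2 * (w \<bullet> w)) * k = r\<^sup>2 / (w \<bullet> (T - c))"
    using k w by (simp add: power2_eq_square)
  finally show ?thesis by (simp add: pole_def proj)
qed

section \<open>One side of the arbelos in an orthonormal frame\<close>

text \<open>The internal circle under consideration has radius \<open>R\<close> and lies on the side of \<open>l\<close> to which \<open>-e\<close>
  points; \<open>R'\<close> belongs to the opposite one.\<close>

locale arbelos_frame =
  fixes M e n :: point and R R' :: real
  assumes norm_e: "norm e = 1" and norm_n: "norm n = 1" and e_n: "e \<bullet> n = 0"
    and R: "R > 0" and R': "R' > 0"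
begin

lemma inner_frame [simp]: "e \<bullet> e = 1" "n \<bullet> n = 1" "e \<bullet> n = 0" "n \<bullet> e = 0"
  using norm_e norm_n e_n by (simp_all add: norm_eq_1 inner_commute)

text \<open>Otherwise the remainder would be a third nonzero vector orthogonal to \<open>e\<close> and \<open>n\<close>, which the
  plane has no room for.\<close>

lemma frame_expansion: "x = (e \<bullet> x) *\<^sub>R e + (n \<bullet> x) *\<^sub>R n"
proof (rule ccontr)
  assume *: "x \<noteq> (e \<bullet> x) *\<^sub>R e + (n \<bullet> x) *\<^sub>R n"
  define y where "y = x - (e \<bullet> x) *\<^sub>R e - (n \<bullet> x) *\<^sub>R n"
  have y: "y \<noteq> 0" "e \<bullet> y = 0" "n \<bullet> y = 0"
    using * by (auto simp: y_def inner_diff_right diff_eq_eq add.commute)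
  have nz: "e \<noteq> 0" "n \<noteq> 0" "e \<noteq> n" "e \<noteq> y" "n \<noteq> y" using inner_frame y by (metis inner_zero_left zero_neq_one)+
  have "pairwise orthogonal {e, n, y}"
    using y by (auto simp: pairwise_def orthogonal_def inner_commute)
  then have "independent {e, n, y}"
    using nz y by (intro pairwise_orthogonal_independent) auto
  then have "card {e, n, y} \<le> 2" using independent_bound[of "{e, n, y}"] by simp
  then show False using nz by simp
qed

lemma frame_eqI: "e \<bullet> x = e \<bullet> y \<Longrightarrow> n \<bullet> x = n \<bullet> y \<Longrightarrow> x = y"
  by (metis frame_expansion)

lemma inner_eq: "x \<bullet> y = (e \<bullet> x) * (e \<bullet> y) + (n \<bullet> x) * (n \<bullet> y)"
  by (subst frame_expansion[of x]) (simp add: inner_add_left)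

lemma dist_square: "(dist x y)\<^sup>2 = (e \<bullet> (x - y))\<^sup>2 + (n \<bullet> (x - y))\<^sup>2"
  unfolding dist_norm power2_norm_eq_inner by (subst inner_eq) (simp only: power2_eq_square)

lemma dist_eq_iff: "d \<ge> 0 \<Longrightarrow> dist x y = d \<longleftrightarrow> (e \<bullet> (x - y))\<^sup>2 + (n \<bullet> (x - y))\<^sup>2 = d\<^sup>2"
  by (metis dist_square power2_eq_iff_nonneg zero_le_dist)

abbreviation "l \<equiv> {x. e \<bullet> (x - M) = 0}"
abbreviation "H \<equiv> {x. n \<bullet> (x - M) > 0}"
abbreviation "P \<equiv> M - R *\<^sub>R e"
abbreviation "P' \<equiv> M + R' *\<^sub>R e"
abbreviation "Q \<equiv> M + (R' - R) *\<^sub>R e"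

definition "radius = R * R' / (R + R')"
definition "center = M - radius *\<^sub>R e + (2 * sqrt (R * radius)) *\<^sub>R n"

lemma radius_pos: "radius > 0"
  using R R' by (simp add: radius_def)

lemma center_coords:
  "e \<bullet> (center - M) = - radius" "n \<bullet> (center - M) = 2 * sqrt (R * radius)"
  by (simp_all add: center_def inner_add_right inner_diff_right)

text \<open>The distance from \<open>P\<close> determines the square of the second coordinate, and the half-plane its
  sign. Both the twin and the pole are identified by this criterion, so the second coordinate of the
  pole never has to be brought into the form \<open>2 sqrt (R r)\<close>.\<close>

lemma center_eqI:
  assumes "e \<bullet> (c - M) = - radius" "n \<bullet> (c - M) > 0" "dist c P = R + radius"
  shows "c = center"
proof -
  have "(e \<bullet> (c - P))\<^sup>2 + (n \<bullet> (c - P))\<^sup>2 = (R + radius)\<^sup>2"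
    using assms(3) dist_square by metis
  moreover have "e \<bullet> (c - P) = R - radius" "n \<bullet> (c - P) = n \<bullet> (c - M)"
    using assms(1) by (simp_all add: inner_diff_right)
  ultimately have "(R - radius)\<^sup>2 + (n \<bullet> (c - M))\<^sup>2 = (R + radius)\<^sup>2" by simp
  then have "(n \<bullet> (c - M))\<^sup>2 = (R + radius)\<^sup>2 - (R - radius)\<^sup>2" by linarith
  also have "\<dots> = 4 * (R * radius)" by (simp add: power2_eq_square algebra_simps)
  finally have "(n \<bullet> (c - M))\<^sup>2 = 4 * (R * radius)" .
  then have "n \<bullet> (c - M) = sqrt (4 * (R * radius))"
    using assms(2) by (metis less_imp_le real_sqrt_unique)
  then have "n \<bullet> (c - M) = 2 * sqrt (R * radius)" by (simp add: real_sqrt_mult)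
  then show ?thesis
    using assms(1) center_coords by (intro frame_eqI) (simp_all add: inner_diff_right)
qed

lemma tangent_to_l_iff:
  assumes "r > 0"
  shows "(\<exists>T. tangent_line_at l (sphere c r) T) \<longleftrightarrow> \<bar>e \<bullet> (c - M)\<bar> = r"
proof
  assume "\<exists>T. tangent_line_at l (sphere c r) T"
  then obtain T where "tangent_line_at l (sphere c r) T" ..
  then have T: "dist c T = r" "l = {x. (T - c) \<bullet> (x - T) = 0}"
    by (simp_all only: tangent_line_at_iff[OF assms])
  have "M \<in> l" "M + n \<in> l" "T \<in> {x. (T - c) \<bullet> (x - T) = 0}" by auto
  then have 1: "(T - c) \<bullet> (M - T) = 0" "(T - c) \<bullet> (M + n - T) = 0" "e \<bullet> (T - M) = 0"
    using T(2) by blast+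
  then have "(T - c) \<bullet> n = 0" by (simp add: inner_diff_right inner_add_right)
  then have "n \<bullet> (c - T) = 0" by (simp add: inner_commute inner_diff_right inner_diff_left)
  then have "(e \<bullet> (c - T))\<^sup>2 = r\<^sup>2" using dist_square[of c T] T by simp
  moreover have "e \<bullet> (c - T) = e \<bullet> (c - M)" using 1(3) by (simp add: inner_diff_right)
  ultimately show "\<bar>e \<bullet> (c - M)\<bar> = r" using assms by (metis abs_of_pos power2_eq_iff_nonneg
        abs_ge_zero less_imp_le power2_abs)
next
  assume *: "\<bar>e \<bullet> (c - M)\<bar> = r"
  define T where "T = c - (e \<bullet> (c - M)) *\<^sub>R e"
  have "dist c T = r" using * by (simp add: T_def dist_norm norm_e)
  moreover have "(T - c) \<bullet> (x - T) = - (e \<bullet> (c - M)) * (e \<bullet> (x - M))" for x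
    by (simp add: T_def inner_diff_right algebra_simps)
  then have "l = {x. (T - c) \<bullet> (x - T) = 0}" using * assms by auto
  ultimately have "tangent_line_at l (sphere c r) T"
    unfolding tangent_line_at_iff[OF assms] by (intro conjI)
  then show "\<exists>T. tangent_line_at l (sphere c r) T" ..
qed

text \<open>A closed half-plane is only given by some normal vector \<open>a\<close>. Since \<open>M\<close> and \<open>M + n\<close> lie on its
  boundary \<open>l\<close>, \<open>a\<close> is a multiple of \<open>e\<close>, and since \<open>P\<close> belongs to the half-plane, it is a
  negative one. The point \<open>c + r e\<close> of the circle then decides the sign of \<open>e \<bullet> (c - M)\<close>.\<close>

lemma sphere_on_left_iff:
  assumes "r > 0" "\<bar>e \<bullet> (c - M)\<bar> = r"
  shows "(\<exists>K. closed_half_plane l K \<and> P \<in> K \<and> sphere c r \<subseteq> K) \<longleftrightarrow> e \<bullet> (c - M) = - r"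
proof
  assume "\<exists>K. closed_half_plane l K \<and> P \<in> K \<and> sphere c r \<subseteq> K"
  then obtain a b where a: "a \<noteq> 0" and l: "l = {x. a \<bullet> x = b}"
    and P: "a \<bullet> P \<ge> b" and sub: "sphere c r \<subseteq> {x. a \<bullet> x \<ge> b}"
    unfolding closed_half_plane_def by auto
  have "M \<in> l" "M + n \<in> l" by auto
  then have M: "a \<bullet> M = b" and "a \<bullet> n = 0" unfolding l by (auto simp: inner_add_right)
  then have *: "a \<bullet> x - b = (a \<bullet> e) * (e \<bullet> (x - M))" for x
    using inner_eq[of a "x - M"] by (simp add: inner_diff_right inner_commute)
  have "a \<bullet> e \<noteq> 0"
    using a \<open>a \<bullet> n = 0\<close> frame_expansion[of a] by (auto simp: inner_commute)
  moreover have "(a \<bullet> e) * (- R) \<ge> 0" using P *[of P] by (simp add: inner_diff_right mult.commute)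
  ultimately have neg: "a \<bullet> e < 0" using R by (simp add: mult_le_0_iff)
  have "c + r *\<^sub>R e \<in> sphere c r" using assms(1) by (simp add: dist_norm norm_e)
  then have "a \<bullet> (c + r *\<^sub>R e) - b \<ge> 0" using sub by auto
  then have "e \<bullet> (c + r *\<^sub>R e - M) \<le> 0"
    unfolding * using neg by (simp add: zero_le_mult_iff)
  then have "e \<bullet> (c - M) + r \<le> 0" by (simp add: inner_diff_right inner_add_right)
  then show "e \<bullet> (c - M) = - r" using assms by auto
next
  assume *: "e \<bullet> (c - M) = - r"
  define K where "K = {x. (- e) \<bullet> x \<ge> (- e) \<bullet> M}"
  have "e \<noteq> 0" using norm_e by auto
  then have "closed_half_plane l K"
    unfolding closed_half_plane_def K_def
    by (intro exI[of _ "- e"] exI[of _ "(- e) \<bullet> M"]) (auto simp: inner_diff_right)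
  moreover have "P \<in> K" using R by (simp add: K_def inner_diff_right)
  moreover have "x \<in> K" if "x \<in> sphere c r" for x
  proof -
    have "e \<bullet> (x - c) \<le> r"
      using norm_cauchy_schwarz[of e "x - c"] that norm_e
      by (simp add: dist_norm norm_minus_commute)
    then show ?thesis using * by (simp add: K_def inner_diff_right)
  qed
  ultimately show "\<exists>K. closed_half_plane l K \<and> P \<in> K \<and> sphere c r \<subseteq> K" by blast
qed

text \<open>Once tangency is expressed by distances, the two equations in \<open>r\<close> and the second coordinate \<open>y\<close>
  of \<open>c\<close> have the same \<open>y\<^sup>2\<close>, and their difference is linear in \<open>r\<close>.\<close>

lemma is_twin_iff: "is_twin H l P R Q (R + R') c r \<longleftrightarrow> c = center \<and> r = radius"
proof -
  have twin: "is_twin H l P R Q (R + R') c r \<longleftrightarrow>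
      r > 0 \<and> n \<bullet> (c - M) > 0 \<and> e \<bullet> (c - M) = - r \<and>
      dist c P = R + r \<and> r < R + R' \<and> dist c Q = R + R' - r" (is "_ \<longleftrightarrow> ?C")
  proof (cases "r > 0")
    case True
    then show ?thesis
      using R sphere_on_left_iff[of r c]
      by (auto simp: is_twin_def tangent_to_l_iff externally_tangent_at_iff
          internally_tangent_at_iff add.commute)
  qed (simp add: is_twin_def)
  have coords: "e \<bullet> (c - P) = e \<bullet> (c - M) + R" "n \<bullet> (c - P) = n \<bullet> (c - M)"
    "e \<bullet> (c - Q) = e \<bullet> (c - M) - (R' - R)" "n \<bullet> (c - Q) = n \<bullet> (c - M)" for c
    by (simp_all add: inner_diff_right inner_add_right)
  have "?C \<longleftrightarrow> c = center \<and> r = radius"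
  proof
    assume C: ?C
    define y where "y = n \<bullet> (c - M)"
    have 1: "(R - r)\<^sup>2 + y\<^sup>2 = (R + r)\<^sup>2"
      using C R dist_square[of c P] unfolding coords y_def by simp
    have 2: "(- r - (R' - R))\<^sup>2 + y\<^sup>2 = (R + R' - r)\<^sup>2"
      using C R dist_square[of c Q] unfolding coords y_def by simp
    have "4 * (r * (R + R')) = 4 * (R * R')"
      using 1 2 by (simp add: power2_eq_square algebra_simps)
    then have "r = radius" using R R' by (simp add: radius_def field_simps)
    moreover from this have "c = center" using C by (intro center_eqI) auto
    ultimately show "c = center \<and> r = radius" by simp
  next
    assume *: "c = center \<and> r = radius"
    have rad: "radius * (R + R') = R * R'" using R R' by (simp add: radius_def)
    have less: "radius < R + R'"
    proof -
      have "radius < R'" using R R' by (simp add: radius_def field_simps)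
      then show ?thesis using R by simp
    qed
    have y2: "(2 * sqrt (R * radius))\<^sup>2 = 4 * (R * radius)"
      using R radius_pos by (simp add: power_mult_distrib)
    have "dist center P = R + radius"
      using R radius_pos
      by (subst dist_eq_iff)
        (auto simp: coords center_coords y2, simp add: power2_eq_square algebra_simps)
    moreover have "dist center Q = R + R' - radius"
      using R radius_pos less rad
      by (subst dist_eq_iff)
        (auto simp: coords center_coords y2, simp add: power2_eq_square algebra_simps)
    ultimately show ?C
      using * less R radius_pos by (simp add: center_coords)
  qed
  then show ?thesis using twin by simp
qed

text \<open>A tangent through \<open>P'\<close> touches the circle with centre \<open>c\<close> and radius \<open>s\<close> at \<open>c + w\<close>, where
  \<open>w \<bullet> w = s\<^sup>2\<close> and \<open>w \<bullet> (P' - c) = s\<^sup>2\<close>. As \<open>P' - c = d e\<close>, this leaves two vectors \<open>w\<close>, of which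
  one points into \<open>H\<close>; so the tangent is unique and its pole follows from \<open>pole_hyperplane\<close>.\<close>

lemma pole_tangent_from:
  "pole P R (tangent_from P' (circle_on_diameter P M) H) = center"
proof -
  define s where "s = R / 2"
  define d where "d = R' + s"
  define c where "c = M - s *\<^sub>R e"
  define h where "h = sqrt (s\<^sup>2 - (s\<^sup>2 / d)\<^sup>2)"
  define w where "w = (s\<^sup>2 / d) *\<^sub>R e + h *\<^sub>R n"
  define p where "p = {x. w \<bullet> (x - (c + w)) = 0}"
  have s: "s > 0" "s < d" "d > 0" "R = 2 * s" "R' = d - s" using R R' by (simp_all add: s_def d_def)
  have circle: "circle_on_diameter P M = sphere c s"
  proof -
    have "midpoint P M = c"
      by (rule frame_eqI; unfold midpoint_def c_def s_def inner_scaleR_right inner_add_right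
          inner_diff_right) simp_all
    moreover have "dist P M = R" using R by (simp add: dist_norm norm_e)
    ultimately show ?thesis by (simp add: circle_on_diameter_def s_def)
  qed
  have h: "h > 0" "(s\<^sup>2 / d)\<^sup>2 + h\<^sup>2 = s\<^sup>2"
  proof -
    have "s\<^sup>2 / d < s" using s by (simp add: power2_eq_square field_simps)
    then have "(s\<^sup>2 / d)\<^sup>2 < s\<^sup>2" using s by (intro power_strict_mono) auto
    then show "h > 0" "(s\<^sup>2 / d)\<^sup>2 + h\<^sup>2 = s\<^sup>2" by (simp_all add: h_def)
  qed
  have w: "e \<bullet> w = s\<^sup>2 / d" "n \<bullet> w = h" by (simp_all add: w_def inner_add_right)
  have ww: "w \<bullet> w = s\<^sup>2" using inner_eq[of w w] h by (simp add: w power2_eq_square)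
  have P'c: "P' - c = d *\<^sub>R e" by (simp add: c_def d_def algebra_simps)
  have tangent: "tangent_line_at p (sphere c s) (c + w)"
    using s ww by (simp add: tangent_line_at_iff p_def dist_norm norm_eq_sqrt_inner)
  have P'p: "P' \<in> p"
  proof -
    have "w \<bullet> (P' - (c + w)) = w \<bullet> (P' - c) - w \<bullet> w"
      by (simp add: inner_diff_right inner_add_right)
    also have "\<dots> = 0" unfolding P'c ww using s(3) w(1) by (simp add: inner_commute)
    finally show ?thesis by (simp add: p_def)
  qed
  have "tangent_from P' (circle_on_diameter P M) H = p"
    unfolding tangent_from_def circle
  proof (rule the_equality)
    have "n \<bullet> (c + w - M) > 0" using h w by (simp add: c_def inner_add_right inner_diff_right)
    then show "P' \<in> p \<and> (\<exists>T\<in>H. tangent_line_at p (sphere c s) T)"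
      using tangent P'p by blast
    fix q assume "P' \<in> q \<and> (\<exists>T\<in>H. tangent_line_at q (sphere c s) T)"
    then obtain T where T: "n \<bullet> (T - M) > 0" "dist c T = s" "(T - c) \<bullet> (P' - T) = 0"
      and q: "q = {x. (T - c) \<bullet> (x - T) = 0}"
      using tangent_line_at_iff[OF s(1)] by auto
    define v where "v = T - c"
    have vv: "v \<bullet> v = s\<^sup>2"
      using T(2) by (simp add: v_def dist_norm norm_minus_commute flip: power2_norm_eq_inner)
    have "v \<bullet> (P' - c) - v \<bullet> v = v \<bullet> (P' - T)"
      by (simp add: v_def inner_diff_right inner_add_right)
    also have "\<dots> = 0" using T(3) unfolding v_def .
    finally have ve: "e \<bullet> v = s\<^sup>2 / d"
      unfolding P'c vv using s(3) by (simp add: inner_commute field_simps)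
    have "n \<bullet> v > 0" using T(1) by (simp add: v_def c_def inner_diff_right)
    moreover have "(n \<bullet> v)\<^sup>2 = h\<^sup>2"
      using vv inner_eq[of v v] ve h by (simp add: power2_eq_square)
    ultimately have "n \<bullet> v = h" using h by (metis less_imp_le power2_eq_iff_nonneg)
    then have "v = w" using ve w by (intro frame_eqI) auto
    then have "T = c + w" by (simp add: v_def algebra_simps)
    then show "q = p" using q by (simp add: p_def)
  qed
  moreover have wP: "w \<bullet> (c + w - P) = s\<^sup>2 * (s + d) / d"
  proof -
    have "c + w - P = w + s *\<^sub>R e" using s(4) by (simp add: c_def algebra_simps flip: scaleR_add_left)
    then have "w \<bullet> (c + w - P) = w \<bullet> (w + s *\<^sub>R e)" by (rule arg_cong)
    also have "\<dots> = s\<^sup>2 + s * (s\<^sup>2 / d)"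
      using w(1) by (simp add: inner_add_right ww inner_commute)
    finally have "w \<bullet> (c + w - P) = s\<^sup>2 + s * (s\<^sup>2 / d)" .
    then show ?thesis using s by (simp add: field_simps)
  qed
  ultimately have D: "pole P R (tangent_from P' (circle_on_diameter P M) H) =
      P + (R\<^sup>2 / (s\<^sup>2 * (s + d) / d)) *\<^sub>R w"
    using s pole_hyperplane[of w "c + w" P R] by (simp add: p_def)
  define k where "k = R\<^sup>2 / (s\<^sup>2 * (s + d) / d)"
  have k: "k = 4 * d / (s + d)" "k > 0" using s by (simp_all add: k_def power2_eq_square)
  have rad: "radius = 2 * s * (d - s) / (s + d)"
    unfolding radius_def unfolding s(4,5) by (simp add: add.commute)
  have nz: "s + d \<noteq> 0" "d \<noteq> 0" using s(1,3) by auto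
  have "P + k *\<^sub>R w = center"
  proof (rule center_eqI)
    have "e \<bullet> (P + k *\<^sub>R w - M) = - R + k * (s\<^sup>2 / d)"
      by (simp add: inner_add_right inner_diff_right w)
    also have "\<dots> = - radius"
      unfolding rad k(1) unfolding s(4) using nz by (simp add: field_simps power2_eq_square)
    finally show "e \<bullet> (P + k *\<^sub>R w - M) = - radius" .
    show "n \<bullet> (P + k *\<^sub>R w - M) > 0"
      using h(1) k(2) by (simp add: inner_add_right inner_diff_right w)
    have "dist (P + k *\<^sub>R w) P = k * s"
      using k(2) s(1) ww by (simp add: dist_norm norm_eq_sqrt_inner[of w])
    also have "\<dots> = R + radius"
      unfolding rad k(1) unfolding s(4) using nz by (simp add: field_simps)
    finally show "dist (P + k *\<^sub>R w) P = R + radius" .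
  qed
  then show ?thesis using D k_def by simp
qed

lemma dist_center: "dist P center = R + radius"
  using is_twin_iff[of center radius] R radius_pos
  by (auto simp: is_twin_def externally_tangent_at_iff dist_commute add.commute)

end

section \<open>Both sides of the arbelos\<close>

text \<open>The distances between the centres are \<open>O1 O2 = R1 + R2\<close>, \<open>O1 Q = R2\<close> and \<open>O2 Q = R1\<close>. Measured
  along the line from \<open>O1\<close>, the distance \<open>O1 Q\<close> allows the positions \<open>R2\<close> and \<open>-R2\<close> of \<open>Q\<close>, and
  \<open>O2 Q\<close> rules out the second.\<close>

lemma arbelos_coordinates:
  assumes "arbelos O1 R1 O2 R2 M Q A1 A2"
  defines "e \<equiv> (1 / (R1 + R2)) *\<^sub>R (O2 - O1)"
  shows "norm e = 1" "O1 = M - R1 *\<^sub>R e" "O2 = M + R2 *\<^sub>R e" "Q = M + (R2 - R1) *\<^sub>R e"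
proof -
  have R: "R1 > 0" "R2 > 0" and ext: "externally_tangent_at O1 R1 O2 R2 M"
    and Q: "Q \<in> affine hull {O1, O2}"
    and int: "internally_tangent_at O1 R1 Q (R1 + R2) A1"
      "internally_tangent_at O2 R2 Q (R1 + R2) A2"
    using assms(1) by (auto simp: arbelos_def)
  have d: "dist O1 O2 = R1 + R2" and M: "M = O1 + (R1 / (R1 + R2)) *\<^sub>R (O2 - O1)"
    using ext R by (simp_all add: externally_tangent_at_iff)
  have e: "O2 = O1 + (R1 + R2) *\<^sub>R e" using R by (simp add: e_def)
  show norm_e: "norm e = 1"
    using d R by (simp add: e_def dist_norm norm_minus_commute)
  have "M = O1 + R1 *\<^sub>R e" unfolding M e_def by simp
  then show O1: "O1 = M - R1 *\<^sub>R e" by simp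
  then show O2: "O2 = M + R2 *\<^sub>R e" using e by (simp add: algebra_simps)
  obtain u v where uv: "Q = u *\<^sub>R O1 + v *\<^sub>R O2" "u + v = 1"
    using Q by (auto simp: affine_hull_2)
  define t where "t = v * (R1 + R2)"
  have "Q = O1 + t *\<^sub>R e"
  proof -
    have "Q = (u + v) *\<^sub>R O1 + t *\<^sub>R e"
      unfolding uv(1) by (subst e) (simp add: t_def algebra_simps)
    then show ?thesis using uv(2) by simp
  qed
  then have "dist O1 Q = \<bar>t\<bar>" "dist O2 Q = \<bar>t - (R1 + R2)\<bar>"
  proof -
    assume Q: "Q = O1 + t *\<^sub>R e"
    show "dist O1 Q = \<bar>t\<bar>" by (simp add: Q dist_norm norm_e)
    have "Q - O2 = (t - (R1 + R2)) *\<^sub>R e" by (subst e) (simp add: Q algebra_simps)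
    then show "dist O2 Q = \<bar>t - (R1 + R2)\<bar>"
      by (simp add: dist_commute[of O2] dist_norm[of Q] norm_e)
  qed
  moreover have "dist O1 Q = R2" "dist O2 Q = R1"
    using int R by (simp_all add: internally_tangent_at_iff)
  ultimately have "t = R2" using R by linarith
  then show "Q = M + (R2 - R1) *\<^sub>R e"
    using \<open>Q = O1 + t *\<^sub>R e\<close> O1 by (simp add: algebra_simps)
qed

lemma open_half_plane_unit_normal:
  assumes "open_half_plane p H" "M \<in> p"
  obtains n where "norm n = 1" "\<And>x. x \<in> p \<longleftrightarrow> n \<bullet> (x - M) = 0" "H = {x. n \<bullet> (x - M) > 0}"
proof -
  obtain a b where a: "a \<noteq> 0" and p: "p = {x. a \<bullet> x = b}" and H: "H = {x. a \<bullet> x > b}"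
    using assms(1) by (auto simp: open_half_plane_def)
  have b: "b = a \<bullet> M" using assms(2) p by simp
  show ?thesis
  proof (rule that[of "(1 / norm a) *\<^sub>R a"])
    show "norm ((1 / norm a) *\<^sub>R a) = 1" using a by simp
    show "x \<in> p \<longleftrightarrow> (1 / norm a) *\<^sub>R a \<bullet> (x - M) = 0" for x
      using a by (simp add: p b inner_diff_right)
    show "H = {x. (1 / norm a) *\<^sub>R a \<bullet> (x - M) > 0}"
      using a by (auto simp: H b inner_diff_right divide_less_cancel)
  qed
qed

theorem theorem2:
  fixes O1 O2 M Q A1 A2 D1 D2 :: point and R1 R2 r1 r2 :: real and H l :: "point set"
  assumes arbelos: "arbelos O1 R1 O2 R2 M Q A1 A2"
    and l: "l = perpendicular_at M O1 O2"
    and H: "open_half_plane (affine hull {O1, O2}) H"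
    and D1: "D1 = pole O1 R1 (tangent_from O2 (circle_on_diameter O1 M) H)"
    and D2: "D2 = pole O2 R2 (tangent_from O1 (circle_on_diameter O2 M) H)"
    and r1: "r1 = dist O1 D1 - R1"
    and r2: "r2 = dist O2 D2 - R2"
  shows "(\<forall>c r. is_twin H l O1 R1 Q (R1 + R2) c r \<longleftrightarrow> c = D1 \<and> r = r1) \<and>
         (\<forall>c r. is_twin H l O2 R2 Q (R1 + R2) c r \<longleftrightarrow> c = D2 \<and> r = r2) \<and>
         (\<exists>T. externally_tangent_at D1 r1 O1 R1 T) \<and>
         (\<exists>T. internally_tangent_at D1 r1 Q (R1 + R2) T) \<and>
         (\<exists>T. tangent_line_at l (sphere D1 r1) T) \<and>
         (\<exists>T. externally_tangent_at D2 r2 O2 R2 T) \<and>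
         (\<exists>T. internally_tangent_at D2 r2 Q (R1 + R2) T) \<and>
         (\<exists>T. tangent_line_at l (sphere D2 r2) T) \<and>
         r1 = r2 \<and> 1 / r1 = 1 / R1 + 1 / R2"
proof -
  define e where "e = (1 / (R1 + R2)) *\<^sub>R (O2 - O1)"
  note coords = arbelos_coordinates[OF arbelos, folded e_def]
  have R: "R1 > 0" "R2 > 0" using arbelos by (simp_all add: arbelos_def)
  have O12: "O1 \<in> affine hull {O1, O2}" "O2 \<in> affine hull {O1, O2}"
    by (simp_all add: hull_inc)
  have M_line: "M \<in> affine hull {O1, O2}"
  proof -
    define k where "k = R1 / (R1 + R2)"
    have "M = O1 + R1 *\<^sub>R e" using coords(2) by simp
    then have "M = (1 - k) *\<^sub>R O1 + k *\<^sub>R O2"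
      by (simp add: e_def k_def algebra_simps)
    moreover have "(1 - k) + k = 1" by simp
    ultimately show ?thesis unfolding affine_hull_2 by blast
  qed
  obtain n where n: "norm n = 1" "\<And>x. x \<in> affine hull {O1, O2} \<longleftrightarrow> n \<bullet> (x - M) = 0"
    and Hn: "H = {x. n \<bullet> (x - M) > 0}"
    using open_half_plane_unit_normal[OF H M_line] by blast
  have "n \<bullet> (O2 - M) = 0" using n(2) O12 by blast
  then have en: "e \<bullet> n = 0" using coords(3) R by (simp add: inner_commute)
  have "O2 - O1 = (R1 + R2) *\<^sub>R e" using R by (simp add: e_def)
  then have le: "l = {x. e \<bullet> (x - M) = 0}" "l = {x. (- e) \<bullet> (x - M) = 0}"
    using R by (auto simp: l perpendicular_at_def orthogonal_def inner_commute)
  \<comment> \<open>The reflection \<open>e \<mapsto> -e\<close> keeps \<open>l\<close> and \<open>H\<close> and exchanges the two internal circles.\<close>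
  interpret left: arbelos_frame M e n R1 R2
    using coords(1) n(1) en R by unfold_locales
  interpret right: arbelos_frame M "- e" n R2 R1
    using coords(1) n(1) en R by unfold_locales auto
  have left_points: "left.P = O1" "left.P' = O2" "left.Q = Q" using coords by simp_all
  have right_points: "right.P = O2" "right.P' = O1" "right.Q = Q"
    using coords by (simp_all add: algebra_simps)
  have D1c: "D1 = left.center"
    using left.pole_tangent_from unfolding left_points D1 Hn by simp
  have D2c: "D2 = right.center"
    using right.pole_tangent_from unfolding right_points D2 Hn by simp
  have r1c: "r1 = left.radius"
    using left.dist_center unfolding left_points r1 D1c by simp
  have r2c: "r2 = right.radius"
    using right.dist_center unfolding right_points r2 D2c by simp
  have twin1: "is_twin H l O1 R1 Q (R1 + R2) c r \<longleftrightarrow> c = D1 \<and> r = r1" for c r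
    using left.is_twin_iff unfolding left_points D1c r1c le(1) Hn by simp
  have twin2: "is_twin H l O2 R2 Q (R1 + R2) c r \<longleftrightarrow> c = D2 \<and> r = r2" for c r
    using right.is_twin_iff unfolding right_points D2c r2c le(2) Hn
    by (simp add: add.commute)
  have "r1 = r2" "1 / r1 = 1 / R1 + 1 / R2"
    using R by (simp_all add: r1c r2c left.radius_def right.radius_def field_simps)
  then show ?thesis
    using twin1 twin2 twin1[of D1 r1] twin2[of D2 r2] unfolding is_twin_def by blast
qed

end
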